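(* Let $L$ be an axiomatic extension of $\mathrm{MTL}$. The following are equivalent: (1) $L$ has the Halldén completeness; (2) there is an $\mathrm{MTL}$-chain $\mathcal{A}$ such that $L$ is complete with respect to $\mathcal{A}$; (3) $L$ is meet irreducible in the lattice of axiomatic extensions of $\mathrm{MTL}$.
   Context: Monoidal t-norm based logic $\mathrm{MTL}$: formulas are built from a denumerable set of propositional variables with the binary connectives $\&,\land,\to$ and the constant $\bot$. Derived connectives: $\neg\varphi:=\varphi\to\bot$, $\varphi\vee\psi:=((\varphi\to\psi)\to\psi)\land((\psi\to\varphi)\to\varphi)$. Axiom schemata: $(\varphi\to\psi)\to((\psi\to\chi)\to(\varphi\to\chi))$; $(\varphi\&\psi)\to\varphi$; $(\varphi\&\psi)\to(\psi\&\varphi)$; $(\varphi\land\psi)\to\varphi$; $(\varphi\land\psi)\to(\psi\land\varphi)$; $(\varphi\&(\varphi\to\psi))\to(\psi\land\varphi)$; $(\varphi\to(\psi\to\chi))\to((\varphi\&\psi)\to\chi)$; $((\varphi\&\psi)\to\chi)\to(\varphi\to(\psi\to\chi))$; $((\varphi\to\psi)\to\chi)\to(((\psi\to\varphi)\to\chi)\to\chi)$; $\bot\to\varphi$. The only rule is modus ponens. An axiomatic extension $L$ of $\mathrm{MTL}$ is a logic obtained from $\mathrm{MTL}$ by adding axiom schemata; $\vdash_L$ denotes provability in $L$. Axiomatic extensions, identified with their sets of theorems, form a lattice under inclusion, with meet given by intersection; $L$ is meet irreducible if $L=L_1\cap L_2$ implies $L=L_1$ or $L=L_2$. An $\mathrm{MTL}$-algebra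 is an algebra $\langle A,*,\Rightarrow,\sqcap,\sqcup,0,1\rangle$ such that $\langle A,\sqcap,\sqcup,0,1\rangle$ is a bounded lattice with minimum $0$ and maximum $1$, $\langle A,*,1\rangle$ is a commutative monoid, $z*x\le y$ iff $z\le x\Rightarrow y$ for all $x,y,z$, and $(x\Rightarrow y)\sqcup(y\Rightarrow x)=1$ for all $x,y$. An $\mathrm{MTL}$-chain is a totally ordered $\mathrm{MTL}$-algebra. Evaluations interpret $\&,\land,\to,\bot$ by $*,\sqcap,\Rightarrow,0$. $L$ is complete with respect to $\mathcal{A}$ if, for every formula $\varphi$, $\vdash_L\varphi$ iff every evaluation into $\mathcal{A}$ gives $\varphi$ the value $1$. $L$ has the Halldén completeness if for all formulas $\varphi,\psi$ with no variables in common, $\vdash_L\varphi\vee\psi$ implies $\vdash_L\varphi$ or $\vdash_L\psi$. *)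

theory Defs
  imports "HOL-Algebra.Group"
begin

section \<open>Axiomatic extensions of MTL\<close>

datatype fm =
    Var nat
  | Bot
  | Conj fm fm  (infixr "\<^bold>&" 75)
  | And fm fm   (infixr "\<^bold>\<and>" 70)
  | Imp fm fm   (infixr "\<^bold>\<rightarrow>" 60)

definition Or :: "fm \<Rightarrow> fm \<Rightarrow> fm"  (infixr "\<^bold>\<or>" 65) where
  "\<phi> \<^bold>\<or> \<psi> = ((\<phi> \<^bold>\<rightarrow> \<psi>) \<^bold>\<rightarrow> \<psi>) \<^bold>\<and> ((\<psi> \<^bold>\<rightarrow> \<phi>) \<^bold>\<rightarrow> \<phi>)"

primrec vars :: "fm \<Rightarrow> nat set" where
  "vars (Var i) = {i}"
| "vars Bot = {}"
| "vars (\<phi> \<^bold>& \<psi>) = vars \<phi> \<union> vars \<psi>"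
| "vars (\<phi> \<^bold>\<and> \<psi>) = vars \<phi> \<union> vars \<psi>"
| "vars (\<phi> \<^bold>\<rightarrow> \<psi>) = vars \<phi> \<union> vars \<psi>"

primrec subst :: "(nat \<Rightarrow> fm) \<Rightarrow> fm \<Rightarrow> fm" where
  "subst \<sigma> (Var i) = \<sigma> i"
| "subst \<sigma> Bot = Bot"
| "subst \<sigma> (\<phi> \<^bold>& \<psi>) = subst \<sigma> \<phi> \<^bold>& subst \<sigma> \<psi>"
| "subst \<sigma> (\<phi> \<^bold>\<and> \<psi>) = subst \<sigma> \<phi> \<^bold>\<and> subst \<sigma> \<psi>"
| "subst \<sigma> (\<phi> \<^bold>\<rightarrow> \<psi>) = subst \<sigma> \<phi> \<^bold>\<rightarrow> subst \<sigma> \<psi>"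

inductive_set MTL_axioms :: "fm set" where
  A1: "(\<phi> \<^bold>\<rightarrow> \<psi>) \<^bold>\<rightarrow> ((\<psi> \<^bold>\<rightarrow> \<chi>) \<^bold>\<rightarrow> (\<phi> \<^bold>\<rightarrow> \<chi>)) \<in> MTL_axioms"
| A2: "(\<phi> \<^bold>& \<psi>) \<^bold>\<rightarrow> \<phi> \<in> MTL_axioms"
| A3: "(\<phi> \<^bold>& \<psi>) \<^bold>\<rightarrow> (\<psi> \<^bold>& \<phi>) \<in> MTL_axioms"
| A4: "(\<phi> \<^bold>\<and> \<psi>) \<^bold>\<rightarrow> \<phi> \<in> MTL_axioms"
| A5: "(\<phi> \<^bold>\<and> \<psi>) \<^bold>\<rightarrow> (\<psi> \<^bold>\<and> \<phi>) \<in> MTL_axioms"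
| A6: "(\<phi> \<^bold>& (\<phi> \<^bold>\<rightarrow> \<psi>)) \<^bold>\<rightarrow> (\<psi> \<^bold>\<and> \<phi>) \<in> MTL_axioms"
| A7a: "(\<phi> \<^bold>\<rightarrow> (\<psi> \<^bold>\<rightarrow> \<chi>)) \<^bold>\<rightarrow> ((\<phi> \<^bold>& \<psi>) \<^bold>\<rightarrow> \<chi>) \<in> MTL_axioms"
| A7b: "((\<phi> \<^bold>& \<psi>) \<^bold>\<rightarrow> \<chi>) \<^bold>\<rightarrow> (\<phi> \<^bold>\<rightarrow> (\<psi> \<^bold>\<rightarrow> \<chi>)) \<in> MTL_axioms"
| A8: "((\<phi> \<^bold>\<rightarrow> \<psi>) \<^bold>\<rightarrow> \<chi>) \<^bold>\<rightarrow> (((\<psi> \<^bold>\<rightarrow> \<phi>) \<^bold>\<rightarrow> \<chi>) \<^bold>\<rightarrow> \<chi>) \<in> MTL_axioms"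
| A9: "Bot \<^bold>\<rightarrow> \<phi> \<in> MTL_axioms"

text \<open>A formula in \<open>S\<close> stands for an axiom schema, so every substitution instance of it
  is an axiom.\<close>

inductive_set thms :: "fm set \<Rightarrow> fm set" for S where
  MTL: "\<phi> \<in> MTL_axioms \<Longrightarrow> \<phi> \<in> thms S"
| schema: "\<phi> \<in> S \<Longrightarrow> subst \<sigma> \<phi> \<in> thms S"
| MP: "\<phi> \<in> thms S \<Longrightarrow> \<phi> \<^bold>\<rightarrow> \<psi> \<in> thms S \<Longrightarrow> \<psi> \<in> thms S"

text \<open>A logic is identified with its set of theorems, so \<open>\<phi> \<in> L\<close> reads as provability
  of \<open>\<phi>\<close> in \<open>L\<close>. The set of added schemata may be infinite, and the inconsistent logic
  is included.\<close>

definition axiomatic_extension :: "fm set \<Rightarrow> bool" where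
  "axiomatic_extension L \<longleftrightarrow> (\<exists>S. L = thms S)"

definition meet_irreducible :: "fm set \<Rightarrow> bool" where
  "meet_irreducible L \<longleftrightarrow>
    (\<forall>L1 L2. axiomatic_extension L1 \<longrightarrow> axiomatic_extension L2 \<longrightarrow>
       L = L1 \<inter> L2 \<longrightarrow> L = L1 \<or> L = L2)"

definition Hallden_complete :: "fm set \<Rightarrow> bool" where
  "Hallden_complete L \<longleftrightarrow>
    (\<forall>\<phi> \<psi>. vars \<phi> \<inter> vars \<psi> = {} \<longrightarrow> \<phi> \<^bold>\<or> \<psi> \<in> L \<longrightarrow> \<phi> \<in> L \<or> \<psi> \<in> L)"


section \<open>MTL-algebras\<close>

text \<open>The monoid unit \<open>\<one>\<close> is also the top element. All axioms are relativised to the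
  carrier; one-element algebras (\<open>bt A = \<one>\<close>) are allowed.\<close>

record 'a mtl_algebra = "'a monoid" +
  imp :: "'a \<Rightarrow> 'a \<Rightarrow> 'a"
  inf_op :: "'a \<Rightarrow> 'a \<Rightarrow> 'a"
  sup_op :: "'a \<Rightarrow> 'a \<Rightarrow> 'a"
  bt :: 'a

definition mtl_le :: "('a, 'm) mtl_algebra_scheme \<Rightarrow> 'a \<Rightarrow> 'a \<Rightarrow> bool" where
  "mtl_le A x y \<longleftrightarrow> inf_op A x y = x"

locale MTL_algebra = comm_monoid A for A (structure) +
  assumes imp_closed: "\<lbrakk>x \<in> carrier A; y \<in> carrier A\<rbrakk> \<Longrightarrow> imp A x y \<in> carrier A"
    and inf_closed: "\<lbrakk>x \<in> carrier A; y \<in> carrier A\<rbrakk> \<Longrightarrow> inf_op A x y \<in> carrier A"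
    and sup_closed: "\<lbrakk>x \<in> carrier A; y \<in> carrier A\<rbrakk> \<Longrightarrow> sup_op A x y \<in> carrier A"
    and bt_closed: "bt A \<in> carrier A"
    and inf_comm: "\<lbrakk>x \<in> carrier A; y \<in> carrier A\<rbrakk> \<Longrightarrow> inf_op A x y = inf_op A y x"
    and inf_assoc: "\<lbrakk>x \<in> carrier A; y \<in> carrier A; z \<in> carrier A\<rbrakk>
      \<Longrightarrow> inf_op A (inf_op A x y) z = inf_op A x (inf_op A y z)"
    and sup_comm: "\<lbrakk>x \<in> carrier A; y \<in> carrier A\<rbrakk> \<Longrightarrow> sup_op A x y = sup_op A y x"
    and sup_assoc: "\<lbrakk>x \<in> carrier A; y \<in> carrier A; z \<in> carrier A\<rbrakk>
      \<Longrightarrow> sup_op A (sup_op A x y) z = sup_op A x (sup_op A y z)"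
    and inf_absorb: "\<lbrakk>x \<in> carrier A; y \<in> carrier A\<rbrakk> \<Longrightarrow> inf_op A x (sup_op A x y) = x"
    and sup_absorb: "\<lbrakk>x \<in> carrier A; y \<in> carrier A\<rbrakk> \<Longrightarrow> sup_op A x (inf_op A x y) = x"
    and bt_least: "x \<in> carrier A \<Longrightarrow> mtl_le A (bt A) x"
    and one_greatest: "x \<in> carrier A \<Longrightarrow> mtl_le A x \<one>"
    and residuation: "\<lbrakk>x \<in> carrier A; y \<in> carrier A; z \<in> carrier A\<rbrakk>
      \<Longrightarrow> mtl_le A (z \<otimes> x) y \<longleftrightarrow> mtl_le A z (imp A x y)"
    and prelinearity: "\<lbrakk>x \<in> carrier A; y \<in> carrier A\<rbrakk>
      \<Longrightarrow> sup_op A (imp A x y) (imp A y x) = \<one>"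

locale MTL_chain = MTL_algebra +
  assumes total: "\<lbrakk>x \<in> carrier A; y \<in> carrier A\<rbrakk> \<Longrightarrow> mtl_le A x y \<or> mtl_le A y x"

primrec eval :: "('a, 'm) mtl_algebra_scheme \<Rightarrow> (nat \<Rightarrow> 'a) \<Rightarrow> fm \<Rightarrow> 'a" where
  "eval A v (Var i) = v i"
| "eval A v Bot = bt A"
| "eval A v (\<phi> \<^bold>& \<psi>) = eval A v \<phi> \<otimes>\<^bsub>A\<^esub> eval A v \<psi>"
| "eval A v (\<phi> \<^bold>\<and> \<psi>) = inf_op A (eval A v \<phi>) (eval A v \<psi>)"
| "eval A v (\<phi> \<^bold>\<rightarrow> \<psi>) = imp A (eval A v \<phi>) (eval A v \<psi>)"

definition complete_wrt :: "fm set \<Rightarrow> ('a, 'm) mtl_algebra_scheme \<Rightarrow> bool" where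
  "complete_wrt L A \<longleftrightarrow>
    (\<forall>\<phi>. \<phi> \<in> L \<longleftrightarrow> (\<forall>v \<in> UNIV \<rightarrow> carrier A. eval A v \<phi> = \<one>\<^bsub>A\<^esub>))"

text \<open>Quantification over all MTL-chains is rendered by quantification over chains whose
  carrier is a subset of a type \<open>'a\<close>. A type variable in a theorem is universally
  quantified, so a result for every infinite \<open>'a\<close> covers chains of arbitrary size in
  one direction and yields a chain on \<open>nat\<close> in the other.\<close>

end

theory Submission
  imports Defs "HOL-Library.Countable"
begin

text \<open>
  Everything runs through prime theories, i.e. sets of formulas closed under modus ponens, containing
  the axioms of MTL and at least one of \<open>\<alpha> \<^bold>\<rightarrow> \<beta>\<close>, \<open>\<beta> \<^bold>\<rightarrow> \<alpha>\<close> for all \<open>\<alpha>\<close>, \<open>\<beta>\<close>: their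
  Lindenbaum algebras are countable MTL-chains, and by Zorn's lemma a theory disjoint from an upward
  directed set of formulas extends to a prime one disjoint from that set.

  If \<open>L\<close> is Hallden complete, rename the non-theorems of \<open>L\<close> apart. By Hallden
  completeness no finite disjunction of the renamed formulas is in \<open>L\<close>, so one prime theory
  containing \<open>L\<close> omits all of them, and its chain refutes every non-theorem. If \<open>L\<close> is not
  Hallden complete, witnessed by \<open>\<phi> \<^bold>\<or> \<psi>\<close>, then \<open>L\<close> is the intersection of its
  proper extensions by \<open>\<phi>\<close> and by \<open>\<psi>\<close>, because a prime theory containing \<open>L\<close> contains all
  instances of \<open>\<phi>\<close> or all instances of \<open>\<psi>\<close>.
\<close>

section \<open>Theories of MTL\<close>

text \<open>Closure under substitution is not imposed: the prime theories built below are maximal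
  for omitting certain formulas and may fail to be logics.\<close>

locale mtl_theory =
  fixes T :: "fm set"
  assumes ax: "MTL_axioms \<subseteq> T"
    and mp: "\<lbrakk>x \<^bold>\<rightarrow> y \<in> T; x \<in> T\<rbrakk> \<Longrightarrow> y \<in> T"
begin

section \<open>Derived rules for implication and strong conjunction\<close>

lemma axiom: "x \<in> MTL_axioms \<Longrightarrow> x \<in> T"
  using ax by blast

lemma trans: "\<lbrakk>x \<^bold>\<rightarrow> y \<in> T; y \<^bold>\<rightarrow> z \<in> T\<rbrakk> \<Longrightarrow> x \<^bold>\<rightarrow> z \<in> T"
  by (meson mp axiom A1)

lemma residual: "x \<^bold>& y \<^bold>\<rightarrow> z \<in> T \<longleftrightarrow> x \<^bold>\<rightarrow> (y \<^bold>\<rightarrow> z) \<in> T"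
  by (meson mp axiom A7a A7b)

lemma weaken: "x \<^bold>\<rightarrow> (y \<^bold>\<rightarrow> x) \<in> T"
  using residual axiom A2 by blast

lemma weakenI: "x \<in> T \<Longrightarrow> y \<^bold>\<rightarrow> x \<in> T"
  using mp weaken by blast

lemma conj_commute: "x \<^bold>& y \<^bold>\<rightarrow> y \<^bold>& x \<in> T"
  using axiom A3 by blast

lemma exchange: "x \<^bold>\<rightarrow> (y \<^bold>\<rightarrow> z) \<in> T \<Longrightarrow> y \<^bold>\<rightarrow> (x \<^bold>\<rightarrow> z) \<in> T"
  by (meson residual trans conj_commute)

text \<open>Exchanging \<open>weaken\<close> gives
  \<open>y \<rightarrow> (x \<rightarrow> x)\<close>; an axiom is taken for
  \<open>y\<close>.\<close>

lemma refl: "x \<^bold>\<rightarrow> x \<in> T"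
  by (meson exchange weaken axiom A9 mp)

lemma imp_anti: "x \<^bold>\<rightarrow> y \<in> T \<Longrightarrow> (y \<^bold>\<rightarrow> z) \<^bold>\<rightarrow> (x \<^bold>\<rightarrow> z) \<in> T"
  by (meson axiom A1 mp)

lemma imp_mono: "x \<^bold>\<rightarrow> y \<in> T \<Longrightarrow> (z \<^bold>\<rightarrow> x) \<^bold>\<rightarrow> (z \<^bold>\<rightarrow> y) \<in> T"
  by (meson axiom A1 exchange mp)

lemma conjI: "x \<^bold>\<rightarrow> (y \<^bold>\<rightarrow> x \<^bold>& y) \<in> T"
  using residual refl by blast

lemma conj_mono1: "x \<^bold>\<rightarrow> y \<in> T \<Longrightarrow> x \<^bold>& z \<^bold>\<rightarrow> y \<^bold>& z \<in> T"
  by (meson residual trans conjI)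

lemma conj_mono: "\<lbrakk>x \<^bold>\<rightarrow> y \<in> T; x' \<^bold>\<rightarrow> y' \<in> T\<rbrakk> \<Longrightarrow> x \<^bold>& x' \<^bold>\<rightarrow> y \<^bold>& y' \<in> T"
  by (meson conj_mono1 trans conj_commute)

lemma conj_assoc1: "(x \<^bold>& y) \<^bold>& z \<^bold>\<rightarrow> x \<^bold>& (y \<^bold>& z) \<in> T"
proof -
  have "x \<^bold>\<rightarrow> (y \<^bold>\<rightarrow> (z \<^bold>\<rightarrow> x \<^bold>& (y \<^bold>& z))) \<in> T"
    by (meson conjI trans axiom A7b)
  then show ?thesis
    by (simp add: residual)
qed

text \<open>Commutativity reverses the order of the factors, which reduces this direction to
  \<open>conj_assoc1\<close>.\<close>

lemma conj_assoc2: "x \<^bold>& (y \<^bold>& z) \<^bold>\<rightarrow> (x \<^bold>& y) \<^bold>& z \<in> T"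
proof -
  have "x \<^bold>& (y \<^bold>& z) \<^bold>\<rightarrow> (z \<^bold>& y) \<^bold>& x \<in> T"
    by (meson conj_commute conj_mono refl trans)
  moreover have "z \<^bold>& (y \<^bold>& x) \<^bold>\<rightarrow> (x \<^bold>& y) \<^bold>& z \<in> T"
    by (meson conj_commute conj_mono refl trans)
  ultimately show ?thesis
    by (meson conj_assoc1 trans)
qed

section \<open>Derived rules for the lattice connectives\<close>

lemma and1: "x \<^bold>\<and> y \<^bold>\<rightarrow> x \<in> T"
  using axiom A4 by blast

lemma and_commute: "x \<^bold>\<and> y \<^bold>\<rightarrow> y \<^bold>\<and> x \<in> T"
  using axiom A5 by blast

lemma and2: "x \<^bold>\<and> y \<^bold>\<rightarrow> y \<in> T"
  by (meson and1 and_commute trans)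

lemma imp_and: "(x \<^bold>\<rightarrow> y) \<^bold>\<rightarrow> (x \<^bold>\<rightarrow> y \<^bold>\<and> x) \<in> T"
  by (meson exchange residual axiom A6)

lemma prelinear_cases:
  "\<lbrakk>(x \<^bold>\<rightarrow> y) \<^bold>\<rightarrow> z \<in> T; (y \<^bold>\<rightarrow> x) \<^bold>\<rightarrow> z \<in> T\<rbrakk> \<Longrightarrow> z \<in> T"
  by (meson axiom A8 mp)

text \<open>Prelinearity allows \<open>y\<close> and \<open>z\<close> to be taken as comparable; by
  \<open>imp_and\<close> the smaller of the two then already implies the meet.\<close>

lemma andI:
  assumes "x \<^bold>\<rightarrow> y \<in> T" "x \<^bold>\<rightarrow> z \<in> T"
  shows "x \<^bold>\<rightarrow> y \<^bold>\<and> z \<in> T"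
proof (rule prelinear_cases)
  show "(y \<^bold>\<rightarrow> z) \<^bold>\<rightarrow> (x \<^bold>\<rightarrow> y \<^bold>\<and> z) \<in> T"
    by (meson assms(1) imp_and imp_anti imp_mono and_commute trans)
  show "(z \<^bold>\<rightarrow> y) \<^bold>\<rightarrow> (x \<^bold>\<rightarrow> y \<^bold>\<and> z) \<in> T"
    by (meson assms(2) imp_and imp_anti trans)
qed

lemma imp_assertion: "x \<^bold>\<rightarrow> ((x \<^bold>\<rightarrow> y) \<^bold>\<rightarrow> y) \<in> T"
  using exchange refl by blast

lemma or1: "x \<^bold>\<rightarrow> x \<^bold>\<or> y \<in> T"
  unfolding Or_def by (intro andI imp_assertion weaken)

lemma or2: "y \<^bold>\<rightarrow> x \<^bold>\<or> y \<in> T"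
  unfolding Or_def by (intro andI imp_assertion weaken)

lemma or_elim1: "\<lbrakk>x \<^bold>\<or> y \<in> T; x \<^bold>\<rightarrow> y \<in> T\<rbrakk> \<Longrightarrow> y \<in> T"
  unfolding Or_def by (meson and1 mp)

lemma or_elim2: "\<lbrakk>x \<^bold>\<or> y \<in> T; y \<^bold>\<rightarrow> x \<in> T\<rbrakk> \<Longrightarrow> x \<in> T"
  unfolding Or_def by (meson and2 mp)

text \<open>The members of this set are the formulas \<open>x\<close> for which \<open>x \<^bold>\<or> q\<close> is in \<open>T\<close>; this
  form makes closure under modus ponens immediate.\<close>

lemma disjunction_theory:
  "mtl_theory {x. \<forall>e. x \<^bold>\<rightarrow> e \<in> T \<longrightarrow> q \<^bold>\<rightarrow> e \<in> T \<longrightarrow> e \<in> T}" (is "mtl_theory ?W")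
proof
  show "MTL_axioms \<subseteq> ?W"
    using axiom mp by blast
  fix x y assume xy: "x \<^bold>\<rightarrow> y \<in> ?W" and x: "x \<in> ?W"
  show "y \<in> ?W"
  proof (intro CollectI allI impI)
    \<comment> \<open>The property of \<open>x \<rightarrow> y\<close> is used with
      \<open>x \<rightarrow> e\<close> in place of \<open>e\<close>, which puts
      \<open>x \<rightarrow> e\<close> in \<open>T\<close>; the property of \<open>x\<close> then
      gives \<open>e\<close>.\<close>
    fix e assume "y \<^bold>\<rightarrow> e \<in> T" and q: "q \<^bold>\<rightarrow> e \<in> T"
    then have "(x \<^bold>\<rightarrow> y) \<^bold>\<rightarrow> (x \<^bold>\<rightarrow> e) \<in> T" "q \<^bold>\<rightarrow> (x \<^bold>\<rightarrow> e) \<in> T"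
      by (blast intro: imp_mono trans weaken)+
    then show "e \<in> T"
      using xy x q by blast
  qed
qed

end

lemma mtl_theory_UNIV: "mtl_theory UNIV"
  by unfold_locales auto

lemma mtl_theory_thms: "mtl_theory (thms S)"
  by unfold_locales (auto intro: thms.intros)

lemma mtl_theory_Union:
  assumes "subset.chain X C" "C \<noteq> {}" "\<And>T. T \<in> X \<Longrightarrow> mtl_theory T"
  shows "mtl_theory (\<Union> C)"
proof
  have th: "mtl_theory T" if "T \<in> C" for T
    using assms(1,3) that unfolding subset.chain_def by blast
  show "MTL_axioms \<subseteq> \<Union> C"
    using assms(2) th mtl_theory.ax by blast
  fix x y assume "x \<^bold>\<rightarrow> y \<in> \<Union> C" "x \<in> \<Union> C"
  then obtain T U where "T \<in> C" "x \<^bold>\<rightarrow> y \<in> T" "U \<in> C" "x \<in> U"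
    by blast
  moreover from this have "T \<subseteq> U \<or> U \<subseteq> T"
    using assms(1) unfolding subset_chain_def by blast
  ultimately obtain T where "T \<in> C" "x \<^bold>\<rightarrow> y \<in> T" "x \<in> T"
    by blast
  then show "y \<in> \<Union> C"
    using th mtl_theory.mp by blast
qed

section \<open>Prime theories and separation\<close>

locale prime_theory = mtl_theory +
  assumes linear: "x \<^bold>\<rightarrow> y \<in> T \<or> y \<^bold>\<rightarrow> x \<in> T"
begin

lemma prime: "x \<^bold>\<or> y \<in> T \<Longrightarrow> x \<in> T \<or> y \<in> T"
  using linear or_elim1 or_elim2 by blast

end

text \<open>Let \<open>T\<close> be maximal among the theories above \<open>L\<close> that miss
  \<open>D\<close>. If linearity failed, prelinearity and maximality would give \<open>c\<close> and
  \<open>d\<close> in \<open>D\<close> with their disjunction in \<open>T\<close>; a common upper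
  bound in \<open>D\<close> would then lie in \<open>T\<close>.\<close>

lemma prime_extension:
  assumes "mtl_theory L" "L \<inter> D = {}"
    and directed: "\<And>x y. \<lbrakk>x \<in> D; y \<in> D\<rbrakk> \<Longrightarrow> \<exists>z\<in>D. x \<^bold>\<rightarrow> z \<in> L \<and> y \<^bold>\<rightarrow> z \<in> L"
  obtains T where "prime_theory T" "L \<subseteq> T" "T \<inter> D = {}"
proof -
  define X where "X = {T. mtl_theory T \<and> L \<subseteq> T \<and> T \<inter> D = {}}"
  have "\<exists>M\<in>X. \<forall>T\<in>X. M \<subseteq> T \<longrightarrow> T = M"
  proof (rule subset_Zorn_nonempty)
    show "X \<noteq> {}"
      using assms unfolding X_def by blast
    fix C assume C: "C \<noteq> {}" "subset.chain X C"
    then have "C \<subseteq> X"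
      unfolding subset.chain_def by blast
    moreover have "mtl_theory (\<Union> C)"
      by (rule mtl_theory_Union[OF C(2,1)]) (simp add: X_def)
    ultimately show "\<Union> C \<in> X"
      using C(1) unfolding X_def by blast
  qed
  then obtain T where T: "T \<in> X" and max: "\<And>U. \<lbrakk>U \<in> X; T \<subseteq> U\<rbrakk> \<Longrightarrow> U = T"
    by blast
  interpret mtl_theory T
    using T unfolding X_def by blast
  have LT: "L \<subseteq> T" and TD: "T \<inter> D = {}"
    using T unfolding X_def by blast+
  \<comment> \<open>Such a \<open>p\<close> lies in the theory of \<open>disjunction_theory\<close>
    for \<open>q\<close>, which therefore properly extends \<open>T\<close> and must meet
    \<open>D\<close>.\<close>
  have sep: "\<exists>d\<in>D. \<forall>e. d \<^bold>\<rightarrow> e \<in> T \<longrightarrow> q \<^bold>\<rightarrow> e \<in> T \<longrightarrow> e \<in> T"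
    if p: "\<forall>e. p \<^bold>\<rightarrow> e \<in> T \<longrightarrow> q \<^bold>\<rightarrow> e \<in> T \<longrightarrow> e \<in> T" "p \<notin> T" for p q
  proof (rule ccontr)
    define W where "W = {x. \<forall>e. x \<^bold>\<rightarrow> e \<in> T \<longrightarrow> q \<^bold>\<rightarrow> e \<in> T \<longrightarrow> e \<in> T}"
    have "T \<subseteq> W"
      using mp unfolding W_def by blast
    assume "\<not> ?thesis"
    then have "W \<inter> D = {}"
      unfolding W_def by blast
    then have "W = T"
      using \<open>T \<subseteq> W\<close> LT max disjunction_theory[of q] unfolding X_def W_def[symmetric] by blast
    then show False
      using p unfolding W_def by blast
  qed
  have "x \<^bold>\<rightarrow> y \<in> T \<or> y \<^bold>\<rightarrow> x \<in> T" for x y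
  proof (rule ccontr)
    assume neg: "\<not> ?thesis"
    obtain c where c: "c \<in> D"
      "\<And>e. \<lbrakk>c \<^bold>\<rightarrow> e \<in> T; (y \<^bold>\<rightarrow> x) \<^bold>\<rightarrow> e \<in> T\<rbrakk> \<Longrightarrow> e \<in> T"
      using sep[of "x \<^bold>\<rightarrow> y" "y \<^bold>\<rightarrow> x"] neg prelinear_cases by blast
    \<comment> \<open>The roles are swapped: \<open>c\<close> is now the fixed side, and
      \<open>y \<rightarrow> x\<close>, which is outside \<open>T\<close>, is replaced by a member
      of \<open>D\<close>.\<close>
    obtain d where d: "d \<in> D" "\<And>e. \<lbrakk>d \<^bold>\<rightarrow> e \<in> T; c \<^bold>\<rightarrow> e \<in> T\<rbrakk> \<Longrightarrow> e \<in> T"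
      using sep[of "y \<^bold>\<rightarrow> x" c] neg c(2) by blast
    show False
      using directed[OF c(1) d(1)] d(2) LT TD by blast
  qed
  then have "prime_theory T"
    by unfold_locales
  then show thesis
    using that LT TD by blast
qed

section \<open>The Lindenbaum chain of a prime theory\<close>

text \<open>Equivalence classes are encoded as values of \<open>h\<close>, so that the quotient
  lives on a prescribed type.\<close>

locale lindenbaum = prime_theory T for T +
  fixes h :: "fm \<Rightarrow> 'a"
  assumes h_eq: "h x = h y \<longleftrightarrow> x \<^bold>\<rightarrow> y \<in> T \<and> y \<^bold>\<rightarrow> x \<in> T"
begin

definition rep :: "'a \<Rightarrow> fm" where
  "rep a = inv_into UNIV h a"

definition le :: "'a \<Rightarrow> 'a \<Rightarrow> bool" where
  "le a b \<longleftrightarrow> rep a \<^bold>\<rightarrow> rep b \<in> T"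

definition chain :: "'a mtl_algebra" where
  "chain = \<lparr>carrier = range h, mult = (\<lambda>a b. h (rep a \<^bold>& rep b)), one = h (Bot \<^bold>\<rightarrow> Bot),
    imp = (\<lambda>a b. h (rep a \<^bold>\<rightarrow> rep b)), inf_op = (\<lambda>a b. if le a b then a else b),
    sup_op = (\<lambda>a b. if le a b then b else a), bt = h Bot\<rparr>"

lemma chain_simps [simp]:
  "carrier chain = range h" "a \<otimes>\<^bsub>chain\<^esub> b = h (rep a \<^bold>& rep b)"
  "\<one>\<^bsub>chain\<^esub> = h (Bot \<^bold>\<rightarrow> Bot)" "imp chain a b = h (rep a \<^bold>\<rightarrow> rep b)"
  "inf_op chain a b = (if le a b then a else b)" "sup_op chain a b = (if le a b then b else a)"
  "bt chain = h Bot"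
  by (simp_all add: chain_def)

lemma h_rep: "h (rep (h x)) = h x"
  by (simp add: rep_def f_inv_into_f)

lemma rep_imp: "rep (h x) \<^bold>\<rightarrow> x \<in> T" "x \<^bold>\<rightarrow> rep (h x) \<in> T"
  using h_rep h_eq by blast+

lemma le_h [simp]: "le (h x) (h y) \<longleftrightarrow> x \<^bold>\<rightarrow> y \<in> T"
  unfolding le_def
  using trans[OF trans[OF rep_imp(2)] rep_imp(1), of x y]
    trans[OF trans[OF rep_imp(1)] rep_imp(2), of x y] by blast

lemma h_conj: "h (rep (h x) \<^bold>& rep (h y)) = h (x \<^bold>& y)"
  unfolding h_eq by (simp add: rep_imp conj_mono)

lemma h_imp: "h (rep (h x) \<^bold>\<rightarrow> rep (h y)) = h (x \<^bold>\<rightarrow> y)"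
  unfolding h_eq
  using trans[OF imp_anti[OF rep_imp(2)[of x]] imp_mono[OF rep_imp(1)[of y]]]
    trans[OF imp_anti[OF rep_imp(1)[of x]] imp_mono[OF rep_imp(2)[of y]]] by blast

lemma h_top: "h x = h (Bot \<^bold>\<rightarrow> Bot) \<longleftrightarrow> x \<in> T"
  unfolding h_eq using mp[OF _ refl] weakenI refl by blast

lemma h_and: "h (x \<^bold>\<and> y) = (if x \<^bold>\<rightarrow> y \<in> T then h x else h y)"
  using linear[of x y] by (auto simp: h_eq and1 and2 andI refl)

lemma mtl_le_chain: "mtl_le chain (h x) (h y) \<longleftrightarrow> x \<^bold>\<rightarrow> y \<in> T"
  using linear[of x y] by (auto simp: mtl_le_def h_eq)

lemma MTL_chain_chain: "MTL_chain chain"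
proof
  fix a b c assume "a \<in> carrier chain" "b \<in> carrier chain" "c \<in> carrier chain"
  then obtain x y z where abc: "a = h x" "b = h y" "c = h z"
    by auto
  show "a \<otimes>\<^bsub>chain\<^esub> b \<otimes>\<^bsub>chain\<^esub> c = a \<otimes>\<^bsub>chain\<^esub> (b \<otimes>\<^bsub>chain\<^esub> c)"
    by (simp add: abc h_conj h_eq conj_assoc1 conj_assoc2)
  have "le a b \<or> le b a" "le b c \<or> le c b" "le a c \<or> le c a"
    using linear by (simp_all add: abc)
  moreover have "le a b \<longrightarrow> le b c \<longrightarrow> le a c" "le c b \<longrightarrow> le b a \<longrightarrow> le c a"
    unfolding le_def using trans by blast+
  moreover have "le a c \<longrightarrow> le c a \<longrightarrow> a = c"
    by (simp add: abc h_eq)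
  ultimately show "inf_op chain (inf_op chain a b) c = inf_op chain a (inf_op chain b c)"
    "sup_op chain (sup_op chain a b) c = sup_op chain a (sup_op chain b c)"
    unfolding chain_simps by (cases "le a b"; cases "le b c"; cases "le a c"; force)+
  show "mtl_le chain (c \<otimes>\<^bsub>chain\<^esub> a) b \<longleftrightarrow> mtl_le chain c (imp chain a b)"
    by (simp add: abc h_conj h_imp mtl_le_chain residual)
next
  fix a b assume "a \<in> carrier chain" "b \<in> carrier chain"
  then obtain x y where [simp]: "a = h x" "b = h y"
    by auto
  note lin = linear[of x y]
  show "a \<otimes>\<^bsub>chain\<^esub> b \<in> carrier chain" "imp chain a b \<in> carrier chain"
    "inf_op chain a b \<in> carrier chain" "sup_op chain a b \<in> carrier chain"
    by auto
  show "a \<otimes>\<^bsub>chain\<^esub> b = b \<otimes>\<^bsub>chain\<^esub> a"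
    by (simp add: h_eq conj_commute)
  show "inf_op chain a b = inf_op chain b a" "sup_op chain a b = sup_op chain b a"
    "inf_op chain a (sup_op chain a b) = a" "sup_op chain a (inf_op chain a b) = a"
    using lin by (auto simp: h_eq refl)
  \<comment> \<open>By linearity one of the implications is in \<open>T\<close>, hence so is the
    larger one, which the supremum selects.\<close>
  show "sup_op chain (imp chain a b) (imp chain b a) = \<one>\<^bsub>chain\<^esub>"
    using lin by (simp add: h_imp h_top) (meson mp weakenI)
  show "mtl_le chain a b \<or> mtl_le chain b a"
    using lin by (simp add: mtl_le_chain)
next
  fix a assume "a \<in> carrier chain"
  then obtain x where [simp]: "a = h x"
    by auto
  show "\<one>\<^bsub>chain\<^esub> \<otimes>\<^bsub>chain\<^esub> a = a"
    unfolding chain_simps \<open>a = h x\<close> h_conj h_eq residual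
    by (meson weakenI refl conjI mp)
  then show "a \<otimes>\<^bsub>chain\<^esub> \<one>\<^bsub>chain\<^esub> = a"
    by (simp add: h_conj h_eq) (meson conj_commute trans)
  show "mtl_le chain (bt chain) a"
    by (simp add: mtl_le_chain axiom A9)
  show "mtl_le chain a \<one>\<^bsub>chain\<^esub>"
    by (simp add: mtl_le_chain weakenI refl)
qed auto

text \<open>Every carrier element is the image of a formula, so evaluations into the chain amount to
  substitutions followed by \<open>h\<close>, and validity of a formula becomes membership of all
  its instances in \<open>T\<close>.\<close>

lemma eval_chain: "eval chain (\<lambda>i. h (\<sigma> i)) \<phi> = h (subst \<sigma> \<phi>)"
  by (induction \<phi>) (simp_all add: h_conj h_imp h_and)

lemma complete_wrt_chain:
  assumes "\<And>\<phi> \<sigma>. \<phi> \<in> L \<Longrightarrow> subst \<sigma> \<phi> \<in> T"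
    and "\<And>\<phi>. \<phi> \<notin> L \<Longrightarrow> \<exists>\<sigma>. subst \<sigma> \<phi> \<notin> T"
  shows "complete_wrt L chain"
  unfolding complete_wrt_def
proof (intro allI iffI ballI)
  fix \<phi> and v :: "nat \<Rightarrow> 'a" assume "\<phi> \<in> L" "v \<in> UNIV \<rightarrow> carrier chain"
  then have "v = (\<lambda>i. h (rep (v i)))"
    by (auto simp: Pi_iff rep_def f_inv_into_f)
  then have "eval chain v \<phi> = h (subst (\<lambda>i. rep (v i)) \<phi>)"
    using eval_chain[of "\<lambda>i. rep (v i)" \<phi>] by metis
  then show "eval chain v \<phi> = \<one>\<^bsub>chain\<^esub>"
    using assms(1) \<open>\<phi> \<in> L\<close> by (simp add: h_top)
next
  fix \<phi> assume 1: "\<forall>v\<in>UNIV \<rightarrow> carrier chain. eval chain v \<phi> = \<one>\<^bsub>chain\<^esub>"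
  have "subst \<sigma> \<phi> \<in> T" for \<sigma>
    using bspec[OF 1, of "\<lambda>i. h (\<sigma> i)"] by (simp add: eval_chain h_top)
  then show "\<phi> \<in> L"
    using assms(2) by blast
qed

end

instance fm :: countable
  by countable_datatype

text \<open>Canonical representatives of the classes are coded by natural numbers and injected into
  the infinite type.\<close>

lemma (in prime_theory) lindenbaum_exists:
  assumes "infinite (UNIV :: 'a set)"
  obtains h :: "fm \<Rightarrow> 'a" where "lindenbaum T h"
proof -
  obtain f :: "nat \<Rightarrow> 'a" where f: "inj f"
    using infinite_countable_subset[OF assms] by blast
  define r where "r x = (SOME y. x \<^bold>\<rightarrow> y \<in> T \<and> y \<^bold>\<rightarrow> x \<in> T)" for x
  have r: "x \<^bold>\<rightarrow> r x \<in> T" "r x \<^bold>\<rightarrow> x \<in> T" for x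
    using someI[of "\<lambda>y. x \<^bold>\<rightarrow> y \<in> T \<and> y \<^bold>\<rightarrow> x \<in> T" x] refl unfolding r_def by auto
  have "r x = r y \<longleftrightarrow> x \<^bold>\<rightarrow> y \<in> T \<and> y \<^bold>\<rightarrow> x \<in> T" for x y
  proof
    assume "r x = r y"
    then show "x \<^bold>\<rightarrow> y \<in> T \<and> y \<^bold>\<rightarrow> x \<in> T"
      by (metis r trans)
  next
    \<comment> \<open>Equivalent formulas present the choice operator with the same predicate, hence
      get the same representative.\<close>
    assume "x \<^bold>\<rightarrow> y \<in> T \<and> y \<^bold>\<rightarrow> x \<in> T"
    then have "(x \<^bold>\<rightarrow> z \<in> T \<and> z \<^bold>\<rightarrow> x \<in> T) \<longleftrightarrow> (y \<^bold>\<rightarrow> z \<in> T \<and> z \<^bold>\<rightarrow> y \<in> T)" for z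
      by (meson trans)
    then show "r x = r y"
      unfolding r_def by simp
  qed
  then have "lindenbaum T (\<lambda>x. f (to_nat (r x)))"
    by unfold_locales (simp add: inj_eq[OF f])
  then show thesis
    using that by blast
qed

section \<open>Substitutions\<close>

lemma subst_subst: "subst \<tau> (subst \<sigma> \<phi>) = subst (\<lambda>i. subst \<tau> (\<sigma> i)) \<phi>"
  by (induction \<phi>) auto

lemma subst_Var: "subst Var \<phi> = \<phi>"
  by (induction \<phi>) auto

lemma subst_cong: "(\<And>i. i \<in> vars \<phi> \<Longrightarrow> \<sigma> i = \<tau> i) \<Longrightarrow> subst \<sigma> \<phi> = subst \<tau> \<phi>"
  by (induction \<phi>) auto

lemma subst_Or: "subst \<sigma> (\<phi> \<^bold>\<or> \<psi>) = subst \<sigma> \<phi> \<^bold>\<or> subst \<sigma> \<psi>"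
  by (simp add: Or_def)

lemma vars_Or: "vars (\<phi> \<^bold>\<or> \<psi>) = vars \<phi> \<union> vars \<psi>"
  by (auto simp: Or_def)

lemma vars_rename: "vars (subst (\<lambda>i. Var (f i)) \<phi>) = f ` vars \<phi>"
  by (induction \<phi>) auto

lemma finite_vars: "finite (vars \<phi>)"
  by (induction \<phi>) auto

lemma eval_cong: "(\<And>i. i \<in> vars \<phi> \<Longrightarrow> v i = w i) \<Longrightarrow> eval A v \<phi> = eval A w \<phi>"
  by (induction \<phi>) auto

lemma MTL_axioms_subst: "\<phi> \<in> MTL_axioms \<Longrightarrow> subst \<sigma> \<phi> \<in> MTL_axioms"
  by (induction rule: MTL_axioms.induct) (auto intro: MTL_axioms.intros)

lemma thms_subst: "\<phi> \<in> thms S \<Longrightarrow> subst \<sigma> \<phi> \<in> thms S"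
  by (induction rule: thms.induct)
    (auto simp: subst_subst intro: thms.intros MTL_axioms_subst)

lemma thms_subset:
  assumes "mtl_theory T" "\<And>\<phi> \<sigma>. \<phi> \<in> S \<Longrightarrow> subst \<sigma> \<phi> \<in> T"
  shows "thms S \<subseteq> T"
proof
  fix \<phi> assume "\<phi> \<in> thms S"
  then show "\<phi> \<in> T"
    by induction (use assms mtl_theory.axiom mtl_theory.mp in blast)+
qed

lemma subset_thms: "S \<subseteq> thms S"
  using thms.schema[of _ S Var] by (auto simp: subst_Var)

lemma axiomatic_extension_theory: "axiomatic_extension L \<Longrightarrow> mtl_theory L"
  unfolding axiomatic_extension_def using mtl_theory_thms by blast

lemma axiomatic_extension_subst: "\<lbrakk>axiomatic_extension L; \<phi> \<in> L\<rbrakk> \<Longrightarrow> subst \<sigma> \<phi> \<in> L"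
  unfolding axiomatic_extension_def using thms_subst by blast

lemma axiomatic_extension_rename_iff:
  assumes "axiomatic_extension L" "inj f"
  shows "subst (\<lambda>i. Var (f i)) \<phi> \<in> L \<longleftrightarrow> \<phi> \<in> L"
proof
  assume "subst (\<lambda>i. Var (f i)) \<phi> \<in> L"
  then have "subst (\<lambda>j. Var (inv_into UNIV f j)) (subst (\<lambda>i. Var (f i)) \<phi>) \<in> L"
    by (rule axiomatic_extension_subst[OF assms(1)])
  then show "\<phi> \<in> L"
    by (simp add: subst_subst inv_f_f[OF assms(2)] subst_Var)
qed (rule axiomatic_extension_subst[OF assms(1)])

section \<open>The three equivalent conditions\<close>

text \<open>The meet is the shape of the value of a disjunction. For \<open>x\<close> below
  \<open>y\<close> the inner implication is the top, so the first factor collapses to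
  \<open>y\<close>, and a meet equal to the top has both factors equal to the top.\<close>

lemma (in MTL_chain) imp_imp_eq_one:
  assumes x: "x \<in> carrier A" and y: "y \<in> carrier A" and le: "mtl_le A x y"
    and one: "inf_op A (imp A (imp A x y) y) z = \<one>" and z: "z \<in> carrier A"
  shows "y = \<one>"
proof -
  have "mtl_le A \<one> (imp A x y)"
    using residuation[of x y \<one>] x y le by simp
  then have "imp A x y = \<one>"
    using one_greatest[of "imp A x y"] imp_closed[OF x y] inf_comm[of "imp A x y" \<one>]
    by (simp add: mtl_le_def)
  moreover have "imp A (imp A x y) y = \<one>"
    using one one_greatest[OF imp_closed[OF imp_closed[OF x y] y]] z x y
      inf_assoc[of "imp A (imp A x y) y" "imp A (imp A x y) y" z]
    by (metis imp_closed inf_absorb inf_assoc inf_closed inf_comm mtl_le_def sup_absorb)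
  moreover have "mtl_le A \<one> \<one>"
    by (simp add: one_greatest)
  ultimately have "mtl_le A \<one> y"
    using residuation[of \<one> y \<one>] y by simp
  then show ?thesis
    using one_greatest[OF y] inf_comm[OF y one_closed] by (simp add: mtl_le_def)
qed

lemma (in MTL_chain) eval_closed: "v \<in> UNIV \<rightarrow> carrier A \<Longrightarrow> eval A v \<phi> \<in> carrier A"
  by (induction \<phi>) (auto simp: bt_closed imp_closed inf_closed)

lemma (in MTL_chain) eval_Or_one:
  assumes "v \<in> UNIV \<rightarrow> carrier A" "eval A v (\<phi> \<^bold>\<or> \<psi>) = \<one>"
  shows "eval A v \<phi> = \<one> \<or> eval A v \<psi> = \<one>"
proof -
  have *: "eval A v \<phi> \<in> carrier A" "eval A v \<psi> \<in> carrier A"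
    using eval_closed assms(1) by auto
  show ?thesis
    using total[OF *] assms(2) * imp_imp_eq_one[OF *] imp_imp_eq_one[OF *(2,1)]
    unfolding Or_def eval.simps by (metis imp_closed inf_comm)
qed

text \<open>Countermodels of the two disjuncts in the same chain are glued along the disjoint
  variable sets; the result refutes both disjuncts, hence, by totality, the disjunction.\<close>

lemma chain_complete_imp_Hallden:
  assumes "MTL_chain A" "complete_wrt L A"
  shows "Hallden_complete L"
  unfolding Hallden_complete_def
proof (intro allI impI)
  interpret MTL_chain A by fact
  fix \<phi> \<psi> assume disj: "vars \<phi> \<inter> vars \<psi> = {}" and "\<phi> \<^bold>\<or> \<psi> \<in> L"
  show "\<phi> \<in> L \<or> \<psi> \<in> L"
  proof (rule ccontr)
    assume "\<not> ?thesis"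
    then obtain v w where v: "v \<in> UNIV \<rightarrow> carrier A" "eval A v \<phi> \<noteq> \<one>\<^bsub>A\<^esub>"
      and w: "w \<in> UNIV \<rightarrow> carrier A" "eval A w \<psi> \<noteq> \<one>\<^bsub>A\<^esub>"
      using spec[OF assms(2)[unfolded complete_wrt_def], of \<phi>]
        spec[OF assms(2)[unfolded complete_wrt_def], of \<psi>] by metis
    define u where "u i = (if i \<in> vars \<phi> then v i else w i)" for i
    have u: "u \<in> UNIV \<rightarrow> carrier A"
      using v(1) w(1) by (simp add: u_def Pi_iff)
    have "eval A u \<phi> = eval A v \<phi>" "eval A u \<psi> = eval A w \<psi>"
      using disj by (auto intro!: eval_cong simp: u_def)
    moreover have "eval A u (\<phi> \<^bold>\<or> \<psi>) = \<one>\<^bsub>A\<^esub>"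
      using spec[OF assms(2)[unfolded complete_wrt_def], of "\<phi> \<^bold>\<or> \<psi>"]
        \<open>\<phi> \<^bold>\<or> \<psi> \<in> L\<close> u by metis
    ultimately show False
      using eval_Or_one[OF u] v(2) w(2) by metis
  qed
qed

section \<open>Hallden completeness and meet irreducibility\<close>

text \<open>If \<open>L\<close> were the intersection of two proper extensions, a non-theorem of
  \<open>L\<close> from each, renamed apart, would have their disjunction in both extensions and so
  in \<open>L\<close>.\<close>

lemma Hallden_imp_meet_irreducible:
  assumes L: "axiomatic_extension L" and H: "Hallden_complete L"
  shows "meet_irreducible L"
  unfolding meet_irreducible_def
proof (intro allI impI, rule ccontr)
  fix L1 L2
  assume L1: "axiomatic_extension L1" and L2: "axiomatic_extension L2"
    and eq: "L = L1 \<inter> L2" and "\<not> (L = L1 \<or> L = L2)"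
  then obtain \<phi> \<psi> where \<phi>: "\<phi> \<in> L1" "\<phi> \<notin> L" and \<psi>: "\<psi> \<in> L2" "\<psi> \<notin> L"
    by blast
  interpret L1: mtl_theory L1 using L1 by (rule axiomatic_extension_theory)
  interpret L2: mtl_theory L2 using L2 by (rule axiomatic_extension_theory)
  \<comment> \<open>Shifting the variables of \<open>\<psi>\<close> by a strict bound on those of
    \<open>\<phi>\<close> separates the two formulas.\<close>
  obtain n where n: "\<And>i. i \<in> vars \<phi> \<Longrightarrow> i < n"
    using finite_vars[of \<phi>] unfolding finite_nat_set_iff_bounded by blast
  define \<psi>' where "\<psi>' = subst (\<lambda>i. Var (i + n)) \<psi>"
  have "vars \<phi> \<inter> vars \<psi>' = {}"
    using n by (fastforce simp: \<psi>'_def vars_rename)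
  moreover have "\<psi>' \<in> L2"
    using axiomatic_extension_subst[OF L2 \<psi>(1)] by (simp add: \<psi>'_def)
  then have "\<phi> \<^bold>\<or> \<psi>' \<in> L"
    unfolding eq using \<phi>(1) L1.mp[OF L1.or1] L2.mp[OF L2.or2] by blast
  moreover have "\<psi>' \<notin> L"
    unfolding \<psi>'_def using axiomatic_extension_rename_iff[OF L, of "\<lambda>i. i + n"] \<psi>(2) by simp
  ultimately show False
    using H \<phi>(2) unfolding Hallden_complete_def by blast
qed

lemma meet_irreducible_imp_Hallden:
  assumes L: "axiomatic_extension L" and M: "meet_irreducible L"
  shows "Hallden_complete L"
  unfolding Hallden_complete_def
proof (intro allI impI)
  fix \<phi> \<psi> assume disj: "vars \<phi> \<inter> vars \<psi> = {}" and or: "\<phi> \<^bold>\<or> \<psi> \<in> L"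
  interpret mtl_theory L using L by (rule axiomatic_extension_theory)
  define L1 where "L1 = thms (insert \<phi> L)"
  define L2 where "L2 = thms (insert \<psi> L)"
  have sub: "insert \<phi> L \<subseteq> L1" "insert \<psi> L \<subseteq> L2"
    unfolding L1_def L2_def by (rule subset_thms)+
  have "L1 \<inter> L2 \<subseteq> L"
  proof (rule ccontr)
    assume "\<not> L1 \<inter> L2 \<subseteq> L"
    then obtain \<chi> where \<chi>: "\<chi> \<in> L1" "\<chi> \<in> L2" "\<chi> \<notin> L"
      by blast
    obtain T where T: "prime_theory T" "L \<subseteq> T" "T \<inter> {\<chi>} = {}"
      by (rule prime_extension[of L "{\<chi>}"])
        (use \<chi>(3) mtl_theory_axioms refl in auto)
    interpret T: prime_theory T by fact
    have inst: "subst \<sigma> \<phi> \<in> T \<or> subst \<tau> \<psi> \<in> T" for \<sigma> \<tau>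
    proof -
      \<comment> \<open>Disjointness lets one substitution act as \<open>\<sigma>\<close> on
        \<open>\<phi>\<close> and as \<open>\<tau>\<close> on \<open>\<psi>\<close>, so
        independently chosen instances still form an instance of the disjunction.\<close>
      define \<rho> where "\<rho> i = (if i \<in> vars \<phi> then \<sigma> i else \<tau> i)" for i
      have "subst \<rho> \<phi> = subst \<sigma> \<phi>" "subst \<rho> \<psi> = subst \<tau> \<psi>"
        using disj by (auto intro!: subst_cong simp: \<rho>_def)
      then have "subst \<sigma> \<phi> \<^bold>\<or> subst \<tau> \<psi> \<in> T"
        using axiomatic_extension_subst[OF L or, of \<rho>] T(2) by (auto simp: subst_Or)
      then show ?thesis
        by (rule T.prime)
    qed
    have LT: "subst \<sigma> \<theta> \<in> T" if "\<theta> \<in> L" for \<sigma> \<theta>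
      using axiomatic_extension_subst[OF L that] T(2) by blast
    show False
    proof (cases "\<forall>\<sigma>. subst \<sigma> \<phi> \<in> T")
      case True
      then have "L1 \<subseteq> T"
        unfolding L1_def using LT by (intro thms_subset T.mtl_theory_axioms) auto
      then show False using \<chi> T by blast
    next
      \<comment> \<open>One instance of \<open>\<phi>\<close> outside \<open>T\<close> forces every
        instance of \<open>\<psi>\<close> into \<open>T\<close>, by \<open>inst\<close>.\<close>
      case False
      then have "L2 \<subseteq> T"
        unfolding L2_def using LT inst by (intro thms_subset T.mtl_theory_axioms) auto
      then show False using \<chi> T by blast
    qed
  qed
  then have "L = L1 \<inter> L2"
    using sub by blast
  then have "L = L1 \<or> L = L2"
    using M unfolding meet_irreducible_def axiomatic_extension_def L1_def L2_def by blast
  then show "\<phi> \<in> L \<or> \<psi> \<in> L"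
    using sub by blast
qed

section \<open>From Hallden completeness to a complete chain\<close>

lemma Hallden_imp_generic_prime_theory:
  assumes L: "axiomatic_extension L" and H: "Hallden_complete L"
  obtains T where "prime_theory T" "L \<subseteq> T" "\<And>\<phi>. \<phi> \<notin> L \<Longrightarrow> \<exists>\<sigma>. subst \<sigma> \<phi> \<notin> T"
proof (cases "L = UNIV")
  \<comment> \<open>The inconsistent logic is split off because the disjunctions below start from
    \<open>Bot\<close>, which has to be outside \<open>L\<close>.\<close>
  case True
  have "prime_theory UNIV"
    by (intro prime_theory.intro mtl_theory_UNIV) (simp add: prime_theory_axioms_def)
  then show ?thesis
    using that True by blast
next
  case False
  interpret mtl_theory L using L by (rule axiomatic_extension_theory)
  \<comment> \<open>Pairing gives each formula of the enumeration its own block of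
    variables.\<close>
  define copy where "copy n = subst (\<lambda>i. Var (prod_encode (n, i))) (from_nat n)" for n
  \<comment> \<open>Theorems are skipped, since a disjunct in \<open>L\<close> would put the
    disjunction in \<open>L\<close>; \<open>Bot\<close> serves as the empty disjunction.\<close>
  define d where
    "d = rec_nat Bot (\<lambda>n x. if (from_nat n :: fm) \<in> L then x else x \<^bold>\<or> copy n)"
  have d_simps: "d 0 = Bot"
    "d (Suc n) = (if (from_nat n :: fm) \<in> L then d n else d n \<^bold>\<or> copy n)" for n
    by (simp_all add: d_def)
  have vars_copy: "i \<in> vars (copy n) \<Longrightarrow> fst (prod_decode i) = n" for i n
    by (auto simp: copy_def vars_rename)
  \<comment> \<open>The strict bound keeps \<open>d n\<close> disjoint from \<open>copy n\<close>,
    as the Hallden property demands in the next step.\<close>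
  have vars_d: "i \<in> vars (d n) \<Longrightarrow> fst (prod_decode i) < n" for i n
  proof (induction n)
    case (Suc n)
    then show ?case
      using vars_copy[of i n] by (auto simp: d_simps vars_Or less_Suc_eq split: if_splits)
  qed (simp add: d_simps)
  have d_notin: "d n \<notin> L" for n
  proof (induction n)
    case 0
    then show ?case
      using False mp axiom A9 by (auto simp: d_simps)
  next
    case (Suc n)
    have "vars (d n) \<inter> vars (copy n) = {}"
      using vars_d vars_copy by fastforce
    moreover have "copy n \<in> L \<longleftrightarrow> (from_nat n :: fm) \<in> L"
      unfolding copy_def by (intro axiomatic_extension_rename_iff[OF L]) (simp add: inj_def)
    ultimately show ?case
      using Suc H unfolding Hallden_complete_def by (auto simp: d_simps)
  qed
  \<comment> \<open>Monotonicity makes \<open>range d\<close> directed, as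
    \<open>prime_extension\<close> requires.\<close>
  have d_mono: "d m \<^bold>\<rightarrow> d n \<in> L" if "m \<le> n" for m n
    using that
  proof (induction rule: dec_induct)
    case (step n)
    then show ?case
      using or1 trans by (auto simp: d_simps)
  qed (rule refl)
  obtain T where T: "prime_theory T" "L \<subseteq> T" "T \<inter> range d = {}"
  proof (rule prime_extension[of L "range d"])
    show "L \<inter> range d = {}"
      using d_notin by blast
    fix x y assume "x \<in> range d" "y \<in> range d"
    then obtain m n where "x = d m" "y = d n"
      by blast
    then show "\<exists>z\<in>range d. x \<^bold>\<rightarrow> z \<in> L \<and> y \<^bold>\<rightarrow> z \<in> L"
      using d_mono[of m "max m n"] d_mono[of n "max m n"] by auto
  qed (use mtl_theory_axioms in auto)
  interpret T: prime_theory T by fact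
  show ?thesis
  proof (rule that[OF T(1,2)])
    \<comment> \<open>The witness is the renaming inside \<open>copy\<close>: a theory that omits a
      disjunction omits its disjuncts.\<close>
    fix \<phi> assume "\<phi> \<notin> L"
    then have "d (Suc (to_nat \<phi>)) = d (to_nat \<phi>) \<^bold>\<or> copy (to_nat \<phi>)"
      by (simp add: d_simps)
    then have "copy (to_nat \<phi>) \<notin> T"
      using T(3) T.mp[OF T.or2] by (metis disjoint_iff rangeI)
    then show "\<exists>\<sigma>. subst \<sigma> \<phi> \<notin> T"
      by (auto simp: copy_def)
  qed
qed

lemma Hallden_imp_chain_complete:
  assumes L: "axiomatic_extension L" and H: "Hallden_complete L"
    and inf: "infinite (UNIV :: 'a set)"
  shows "\<exists>A :: 'a mtl_algebra. MTL_chain A \<and> complete_wrt L A"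
proof -
  obtain T where T: "prime_theory T" "L \<subseteq> T" "\<And>\<phi>. \<phi> \<notin> L \<Longrightarrow> \<exists>\<sigma>. subst \<sigma> \<phi> \<notin> T"
    using Hallden_imp_generic_prime_theory[OF L H] by blast
  obtain h :: "fm \<Rightarrow> 'a" where "lindenbaum T h"
    using prime_theory.lindenbaum_exists[OF T(1) inf] by blast
  then interpret lindenbaum T h .
  have "complete_wrt L chain"
    by (rule complete_wrt_chain) (use axiomatic_extension_subst[OF L] T in blast)+
  then show ?thesis
    using MTL_chain_chain by blast
qed

theorem theorem3p3:
  fixes L :: "fm set"
  assumes "axiomatic_extension L"
    and "infinite (UNIV :: 'a set)"
  shows "(Hallden_complete L \<longleftrightarrow>
            (\<exists>A :: 'a mtl_algebra. MTL_chain A \<and> complete_wrt L A)) \<and>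
         ((\<exists>A :: 'a mtl_algebra. MTL_chain A \<and> complete_wrt L A) \<longleftrightarrow>
            meet_irreducible L)"
  using Hallden_imp_chain_complete[OF assms(1) _ assms(2)] chain_complete_imp_Hallden
    Hallden_imp_meet_irreducible[OF assms(1)] meet_irreducible_imp_Hallden[OF assms(1)]
  by blast

end
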